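(* Let $(\mathcal T,d)$ be a duality triangulation of a surface with assigned local lengths $d$. Let $\mathcal T_0$ be the vertices of the triangulation and let $f:\mathcal T_0\to\mathbb R$ be a function. Suppose $(\mathcal T',d')$ is another duality triangulation which is obtained from $(\mathcal T,d)$ by a $2\to2$ bistellar flip on an edge $e$ such that the hinge is locally regular after the flip. Then $$E_{\mathcal T'}(f)\le E_{\mathcal T}(f),$$ where $E_{\mathcal T}$ and $E_{\mathcal T'}$ are the Dirichlet energies corresponding to $(\mathcal T,d)$ and $(\mathcal T',d')$.
   Context: A duality triangulation $(\mathcal T,d)$ of a surface (2-dimensional manifold) is a real function $d$ on directed edges with $d_{ij}^2+d_{jk}^2+d_{ki}^2=d_{ji}^2+d_{ik}^2+d_{kj}^2$ for each triangle $\{i,j,k\}$ and such that $\ell_{ij}=d_{ij}+d_{ji}>0$ are the edge lengths of a nondegenerate Euclidean triangle for each triangle of $\mathcal T$. The numbers $d_{ij}$ are called local lengths. The center $C(\{i,j\})$ of an edge is the point of the line through the edge at signed distance $d_{ij}$ from $i$ in the direction of $j$; the three perpendiculars to the edges of a triangle through the edge centers meet in one point, the center $C(\{i,j,k\})$. For an edge $\{i,j\}$ common to the triangles $\{i,j,k\}$ and $\{i,j,l\}$ (such a pair of triangles is a hinge), $|\bigstar\{i,j\}|=h_k+h_l$, where $h_k$ is the distance from $C(\{i,j,k\})$ to $C(\{i,j\})$, with positive sign if $C(\{i,j,k\})$ is on the same side of the line through $\{i,j\}$ as the triangle $\{i,j,k\}$ and negative sign if on the other side, and $h_l$ is defined likewise.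 The hinge is locally regular if $|\bigstar\{i,j\}|>0$. We write $|\{i,j\}|=\ell_{ij}$. The Dirichlet energy is $E_{\mathcal T}(f)=\frac12\sum_{\{i,j\}\in\mathcal T_1}\frac{|\bigstar\{i,j\}|}{|\{i,j\}|}(f_j-f_i)^2$, where $\mathcal T_1$ is the set of edges. A $2\to2$ bistellar flip on $e=\{i,j\}$, defined when the quadrilateral formed by the hinge $\{i,j,k\},\{i,j,l\}$ embedded isometrically in $\mathbb R^2$ is convex, replaces these triangles by $\{i,k,l\},\{j,k,l\}$, keeps $d$ on all other edges, and defines $d'_{kl},d'_{lk}$ by $d'_{kl}+d'_{lk}=d(k,l)$ and $d_{ik}^2+(d'_{kl})^2+d_{li}^2=d_{ki}^2+d_{il}^2+(d'_{lk})^2$, where $d(k,l)$ is the Euclidean distance of $k$ and $l$ in the embedded hinge. *)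

theory Defs
  imports "HOL-Analysis.Analysis"
begin

text \<open>
  A triangulation is given by its set of triangles, each a three-element set of vertices;
  its edges are the two-element subsets of triangles.
\<close>

definition edges :: "'a set set \<Rightarrow> 'a set set" where
  "edges T = {e. card e = 2 \<and> (\<exists>t\<in>T. e \<subseteq> t)}"

definition link :: "'a set set \<Rightarrow> 'a \<Rightarrow> 'a set set" where
  "link T v = {s. v \<notin> s \<and> insert v s \<in> T}"

definition is_cycle :: "'a set set \<Rightarrow> bool" where
  "is_cycle S \<longleftrightarrow> (\<exists>xs. distinct xs \<and> 3 \<le> length xs \<and>
     S = {{xs ! n, xs ! (Suc n mod length xs)} | n. n < length xs})"

text \<open>
  A pure two-dimensional simplicial complex triangulates a surface without boundary
  iff every vertex link is a cycle. Compactness and connectedness are not required.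
\<close>

definition triangulated_surface :: "'a set set \<Rightarrow> bool" where
  "triangulated_surface T \<longleftrightarrow> (\<forall>t\<in>T. card t = 3) \<and> (\<forall>v\<in>\<Union>T. is_cycle (link T v))"

definition edge_length :: "('a \<Rightarrow> 'a \<Rightarrow> real) \<Rightarrow> 'a \<Rightarrow> 'a \<Rightarrow> real" where
  "edge_length d i j = d i j + d j i"

definition realizes :: "('a \<Rightarrow> 'a \<Rightarrow> real) \<Rightarrow> 'a set \<Rightarrow> ('a \<Rightarrow> real ^ 2) \<Rightarrow> bool" where
  "realizes d t p \<longleftrightarrow> (\<forall>i\<in>t. \<forall>j\<in>t. i \<noteq> j \<longrightarrow> dist (p i) (p j) = edge_length d i j)"

text \<open>
  The values of \<open>d\<close> matter only on directed edges. As triangles have three elements,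
  \<open>{i, j, k} \<in> T\<close> forces \<open>i\<close>, \<open>j\<close>, \<open>k\<close> to be distinct.
\<close>

definition duality_triangulation :: "'a set set \<Rightarrow> ('a \<Rightarrow> 'a \<Rightarrow> real) \<Rightarrow> bool" where
  "duality_triangulation T d \<longleftrightarrow>
     triangulated_surface T \<and>
     (\<forall>i j k. {i, j, k} \<in> T \<longrightarrow>
        (d i j)\<^sup>2 + (d j k)\<^sup>2 + (d k i)\<^sup>2 = (d j i)\<^sup>2 + (d i k)\<^sup>2 + (d k j)\<^sup>2) \<and>
     (\<forall>i j. {i, j} \<in> edges T \<longrightarrow> edge_length d i j > 0) \<and>
     (\<forall>t\<in>T. \<exists>p. realizes d t p \<and> \<not> collinear (p ` t))"

definition edge_center :: "('a \<Rightarrow> 'a \<Rightarrow> real) \<Rightarrow> ('a \<Rightarrow> real ^ 2) \<Rightarrow> 'a \<Rightarrow> 'a \<Rightarrow> real ^ 2" where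
  "edge_center d p i j = p i + (d i j / edge_length d i j) *\<^sub>R (p j - p i)"

definition triangle_center :: "('a \<Rightarrow> 'a \<Rightarrow> real) \<Rightarrow> ('a \<Rightarrow> real ^ 2) \<Rightarrow> 'a set \<Rightarrow> real ^ 2" where
  "triangle_center d p t =
     (THE c. \<forall>i\<in>t. \<forall>j\<in>t. i \<noteq> j \<longrightarrow> (c - edge_center d p i j) \<bullet> (p j - p i) = 0)"

text \<open>
  The signed distance from the center of \<open>{i, j, k}\<close> to the center of \<open>{i, j}\<close>. It does not
  depend on the planar realization chosen. A center on the line through \<open>i\<close> and \<open>j\<close> falls
  under the second case, where the distance is zero.
\<close>

definition height :: "('a \<Rightarrow> 'a \<Rightarrow> real) \<Rightarrow> 'a \<Rightarrow> 'a \<Rightarrow> 'a \<Rightarrow> real" where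
  "height d i j k =
     (let p = (SOME p. realizes d {i, j, k} p);
          c = triangle_center d p {i, j, k};
          h = dist c (edge_center d p i j)
      in if closed_segment c (p k) \<inter> affine hull {p i, p j} = {} then h else - h)"

text \<open>In a triangulated surface, the following sum has exactly two terms for every edge.\<close>

definition dual_length :: "'a set set \<Rightarrow> ('a \<Rightarrow> 'a \<Rightarrow> real) \<Rightarrow> 'a \<Rightarrow> 'a \<Rightarrow> real" where
  "dual_length T d i j = (\<Sum>k | {i, j, k} \<in> T. height d i j k)"

definition locally_regular :: "'a set set \<Rightarrow> ('a \<Rightarrow> 'a \<Rightarrow> real) \<Rightarrow> 'a \<Rightarrow> 'a \<Rightarrow> bool" where
  "locally_regular T d i j \<longleftrightarrow> dual_length T d i j > 0"

text \<open>The value of a symmetric function of two vertices on an unordered edge.\<close>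

definition on_edge :: "('a \<Rightarrow> 'a \<Rightarrow> real) \<Rightarrow> 'a set \<Rightarrow> real" where
  "on_edge F e = (THE y. \<forall>i j. e = {i, j} \<longrightarrow> y = F i j)"

text \<open>
  The unordered sum is the ordinary sum when the triangulation is finite. A flip changes only
  finitely many summands, so it does not affect summability.
\<close>

definition dirichlet_energy :: "'a set set \<Rightarrow> ('a \<Rightarrow> 'a \<Rightarrow> real) \<Rightarrow> ('a \<Rightarrow> real) \<Rightarrow> real" where
  "dirichlet_energy T d f =
     1 / 2 * (\<Sum>\<^sub>\<infinity>e\<in>edges T.
       on_edge (\<lambda>i j. dual_length T d i j / edge_length d i j * (f j - f i)\<^sup>2) e)"

definition embeds_hinge ::
    "('a \<Rightarrow> 'a \<Rightarrow> real) \<Rightarrow> 'a \<Rightarrow> 'a \<Rightarrow> 'a \<Rightarrow> 'a \<Rightarrow> ('a \<Rightarrow> real ^ 2) \<Rightarrow> bool" where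
  "embeds_hinge d i j k l p \<longleftrightarrow>
     realizes d {i, j, k} p \<and> realizes d {i, j, l} p \<and>
     convex hull (p ` {i, j, k}) \<inter> convex hull (p ` {i, j, l}) = closed_segment (p i) (p j)"

text \<open>
  The flip that replaces the edge \<open>{i, j}\<close> of the hinge \<open>{i, j, k}\<close>, \<open>{i, j, l}\<close> by \<open>{k, l}\<close>.
  The embedded hinge is unique up to isometry. A straight angle at \<open>i\<close> or \<open>j\<close> is not
  excluded by convexity, but it makes a triangle of \<open>T'\<close> degenerate.
\<close>

definition bistellar_flip ::
    "'a set set \<Rightarrow> ('a \<Rightarrow> 'a \<Rightarrow> real) \<Rightarrow> 'a \<Rightarrow> 'a \<Rightarrow> 'a \<Rightarrow> 'a \<Rightarrow>
     'a set set \<Rightarrow> ('a \<Rightarrow> 'a \<Rightarrow> real) \<Rightarrow> bool" where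
  "bistellar_flip T d i j k l T' d' \<longleftrightarrow>
     {i, j, k} \<in> T \<and> {i, j, l} \<in> T \<and> k \<noteq> l \<and> {k, l} \<notin> edges T \<and>
     T' = T - {{i, j, k}, {i, j, l}} \<union> {{i, k, l}, {j, k, l}} \<and>
     (\<forall>a b. {a, b} \<in> edges T - {{i, j}} \<longrightarrow> d' a b = d a b) \<and>
     (\<exists>p. embeds_hinge d i j k l p \<and>
        convex (convex hull (p ` {i, j, k}) \<union> convex hull (p ` {i, j, l})) \<and>
        d' k l + d' l k = dist (p k) (p l)) \<and>
     (d i k)\<^sup>2 + (d' k l)\<^sup>2 + (d l i)\<^sup>2 = (d k i)\<^sup>2 + (d i l)\<^sup>2 + (d' l k)\<^sup>2"

end

theory Submission
  imports Defs
begin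

text \<open>
  Embed the hinge in the plane. Its diagonals cross at a point
  \<open>(1 - s) p\<^sub>i + s p\<^sub>j = (1 - r) p\<^sub>k + r p\<^sub>l\<close> with \<open>0 < s, r < 1\<close>. The discrete Laplacians of
  the hinge before and after the flip agree on affine functions, because the dual paths between
  the centers of two consecutive boundary edges have the same end points. So the energies differ
  by a multiple of the square of the affine dependency,
  \<open>((1 - s) f\<^sub>i + s f\<^sub>j - (1 - r) f\<^sub>k - r f\<^sub>l)\<^sup>2\<close>. Comparing the coefficients of \<open>f\<^sub>k f\<^sub>l\<close> shows that
  the multiple is a positive constant times the dual length of the new edge.
\<close>

subsection \<open>The height of a triangle center\<close>

text \<open>\<open>height\<close> rests on \<open>SOME\<close>, \<open>THE\<close> and a case
  distinction about a segment, so it is first turned into algebra: divided by the edge length, it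
  becomes a quotient whose numerator is linear in the numbers \<open>foot\<close>, with inner
  products as coefficients, and whose denominator is the root of \<open>gram\<close>, the squared
  doubled area of the triangle. The condition on local lengths makes every center a power center:
  some vertex weights \<open>w\<close> make |c - p a|^2 - w a the same for all three vertices. If
  each vertex is lifted to the height |p a|^2 - w a, then the factor \<open>defect\<close> common to
  all six weight changes is half the vertical gap between the lifted diagonals over their crossing.
  This is why relabelling the hinge changes at most its sign. The weight changes are computed
  explicitly, which replaces a separate argument about Laplacians.\<close>

definition gram :: "'b::real_inner \<Rightarrow> 'b \<Rightarrow> real" where
  "gram a b = (a \<bullet> a) * (b \<bullet> b) - (a \<bullet> b)\<^sup>2"

lemma collinear_iff_gram: "collinear {x, y, z} \<longleftrightarrow> gram (y - x) (z - x) = 0"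
proof -
  have "collinear {x, y, z} \<longleftrightarrow> collinear {y, x, z}"
    by (simp add: insert_commute)
  also have "\<dots> \<longleftrightarrow> collinear {0, y - x, z - x}"
    by (rule collinear_3) simp
  also have "\<dots> \<longleftrightarrow> \<bar>(y - x) \<bullet> (z - x)\<bar> = norm (y - x) * norm (z - x)"
    by (rule norm_cauchy_schwarz_equal[symmetric])
  also have "\<dots> \<longleftrightarrow> ((y - x) \<bullet> (z - x))\<^sup>2 = (norm (y - x) * norm (z - x))\<^sup>2"
    by (metis abs_ge_zero mult_nonneg_nonneg norm_ge_zero power2_abs power2_eq_iff_nonneg)
  finally show ?thesis
    by (auto simp: gram_def power_mult_distrib power2_norm_eq_inner)
qed

lemma gram_nonneg: "gram a b \<ge> 0"
  unfolding gram_def using Cauchy_Schwarz_ineq[of a b] by simp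

lemma inner_eq_sides:
  fixes x y z :: "'b::real_inner"
  shows "(y - x) \<bullet> (z - x) = ((dist x y)\<^sup>2 + (dist x z)\<^sup>2 - (dist y z)\<^sup>2) / 2"
  by (simp add: dist_norm power2_norm_eq_inner inner_commute algebra_simps)

text \<open>Polarization expresses the inner products through the side lengths. This carries
  nondegeneracy and heights from one planar realization of a triangle to another, in particular to
  the one picked by \<open>SOME\<close> in \<open>height\<close>.\<close>

lemma gram_cong:
  assumes "dist x y = dist x' y'" "dist x z = dist x' z'" "dist y z = dist y' z'"
  shows "gram (y - x) (z - x) = gram (y' - x') (z' - x')"
proof -
  have "(y - x) \<bullet> (y - x) = (y' - x') \<bullet> (y' - x')" "(z - x) \<bullet> (z - x) = (z' - x') \<bullet> (z' - x')"
    using assms by (simp_all add: inner_eq_sides)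
  then show ?thesis
    unfolding gram_def using assms by (simp add: inner_eq_sides[of y x z] inner_eq_sides[of y' x' z'])
qed

text \<open>In the plane \<open>gram a b\<close> is the squared determinant of \<open>a\<close> and
  \<open>b\<close>, so this is Cramer's rule. It gives the uniqueness of the triangle
  center.\<close>

lemma orthogonal_both_eq_0:
  fixes a b x :: "real ^ 2"
  assumes "gram a b \<noteq> 0" "x \<bullet> a = 0" "x \<bullet> b = 0"
  shows "x = 0"
proof -
  have g: "gram a b = (a$1 * b$2 - a$2 * b$1)\<^sup>2"
    by (simp add: gram_def inner_vec_def sum_2 power2_eq_square algebra_simps)
  then have ne: "a$1 * b$2 - a$2 * b$1 \<noteq> 0"
    using assms(1) by auto
  have a: "x$1 * a$1 + x$2 * a$2 = 0" and b: "x$1 * b$1 + x$2 * b$2 = 0"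
    using assms by (simp_all add: inner_vec_def sum_2)
  have "x$1 * (a$1 * b$2 - a$2 * b$1) = 0" "x$2 * (a$1 * b$2 - a$2 * b$1) = 0"
    using a b by algebra+
  with ne have "x$1 = 0" "x$2 = 0" by simp_all
  then show ?thesis by (simp add: vec_eq_iff forall_2)
qed

text \<open>
  The center \<open>c\<close> of a triangle with vertices \<open>a\<close>, \<open>b\<close> satisfies \<open>(c - p a) \<bullet> (p b - p a) = foot d a b\<close>.
\<close>

definition foot :: "('a \<Rightarrow> 'a \<Rightarrow> real) \<Rightarrow> 'a \<Rightarrow> 'a \<Rightarrow> real" where
  "foot d a b = d a b * edge_length d a b"

lemma edge_length_commute: "edge_length d a b = edge_length d b a"
  by (simp add: edge_length_def)

lemma foot_add: "foot d a b + foot d b a = (edge_length d a b)\<^sup>2"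
  by (simp add: foot_def edge_length_def power2_eq_square algebra_simps)

lemma foot_diff: "foot d a b - foot d b a = (d a b)\<^sup>2 - (d b a)\<^sup>2"
  by (simp add: foot_def edge_length_def power2_eq_square algebra_simps)

lemma edge_center_commute:
  assumes "edge_length d a b \<noteq> 0"
  shows "edge_center d p a b = edge_center d p b a"
proof -
  define t where "t = d a b / edge_length d a b"
  have "d b a / edge_length d b a = 1 - t"
    using assms by (simp add: t_def field_simps edge_length_def)
  then show ?thesis
    unfolding edge_center_def t_def[symmetric] by (simp only:) (simp add: algebra_simps)
qed

definition compat :: "('a \<Rightarrow> 'a \<Rightarrow> real) \<Rightarrow> 'a \<Rightarrow> 'a \<Rightarrow> 'a \<Rightarrow> bool" where
  "compat d i j k \<longleftrightarrow>
     (d i j)\<^sup>2 + (d j k)\<^sup>2 + (d k i)\<^sup>2 = (d j i)\<^sup>2 + (d i k)\<^sup>2 + (d k j)\<^sup>2"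

text \<open>Two perpendiculars determine \<open>c\<close>, and \<open>compat\<close> is exactly the
  condition that puts \<open>c\<close> on the third one. So \<open>c\<close> satisfies the
  description under \<open>THE\<close>, and nondegeneracy excludes any other solution.\<close>

lemma triangle_center_eq:
  assumes p: "realizes d {i, j, k} p" and nc: "gram (p j - p i) (p k - p i) \<noteq> 0"
    and compat: "compat d i j k" and dist: "distinct [i, j, k]"
    and ca: "(c - p i) \<bullet> (p j - p i) = foot d i j"
    and cb: "(c - p i) \<bullet> (p k - p i) = foot d i k"
  shows "triangle_center d p {i, j, k} = c"
proof -
  have len: "dist (p i) (p j) = edge_length d i j" "dist (p i) (p k) = edge_length d i k"
    "dist (p j) (p k) = edge_length d j k"
    using p dist by (auto simp: realizes_def)
  have pne: "p i \<noteq> p j" "p i \<noteq> p k" "p j \<noteq> p k"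
    using nc by (auto simp: gram_def power2_eq_square)
  have on: "edge_length d a b \<noteq> 0 \<Longrightarrow> dist (p a) (p b) = edge_length d a b \<Longrightarrow>
      (x - edge_center d p a b) \<bullet> (p b - p a) = (x - p a) \<bullet> (p b - p a) - foot d a b" for x a b
  proof -
    assume ne: "edge_length d a b \<noteq> 0" and len: "dist (p a) (p b) = edge_length d a b"
    have sq: "(p b - p a) \<bullet> (p b - p a) = (edge_length d a b)\<^sup>2"
      by (simp add: len[symmetric] dist_norm norm_minus_commute power2_norm_eq_inner[symmetric])
    have "(x - edge_center d p a b) \<bullet> (p b - p a) = (x - p a) \<bullet> (p b - p a)
        - (d a b / edge_length d a b) * ((p b - p a) \<bullet> (p b - p a))"
      by (simp only: edge_center_def inner_diff_left inner_add_left inner_scaleR_left)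
    then show ?thesis using ne
      unfolding sq by (simp add: foot_def power2_eq_square)
  qed
  have ne: "edge_length d i j \<noteq> 0" "edge_length d i k \<noteq> 0" "edge_length d j k \<noteq> 0"
    using len pne by auto
  note on' = on[OF ne(1) len(1)] on[OF ne(2) len(2)] on[OF ne(3) len(3)]
  \<comment> \<open>Since \<open>foot d a b\<close> is half of the squared length plus
    \<open>(d a b)^2 - (d b a)^2\<close>, all lengths cancel after expansion about
    \<open>p i\<close>, and what remains is \<open>compat\<close>.\<close>
  have jk: "(c - p j) \<bullet> (p k - p j) = foot d j k"
  proof -
    have "(c - p j) \<bullet> (p k - p j) =
      (c - p i) \<bullet> (p k - p i) - (c - p i) \<bullet> (p j - p i)
        - (p j - p i) \<bullet> (p k - p i) + (dist (p i) (p j))\<^sup>2"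
      by (simp add: dist_norm power2_norm_eq_inner inner_commute algebra_simps)
    also have "\<dots> = foot d i k - foot d i j -
        ((edge_length d i j)\<^sup>2 + (edge_length d i k)\<^sup>2 - (edge_length d j k)\<^sup>2) / 2
        + (edge_length d i j)\<^sup>2"
      unfolding ca cb inner_eq_sides[of "p j" "p i" "p k"] len ..
    also have "\<dots> = foot d j k"
      using compat foot_add[of d i j] foot_add[of d i k] foot_add[of d j k]
        foot_diff[of d i j] foot_diff[of d i k] foot_diff[of d j k]
      unfolding compat_def by (simp add: field_simps)
    finally show ?thesis .
  qed
  have swap: "(x - edge_center d p b a) \<bullet> (p a - p b) = 0 \<longleftrightarrow>
      (x - edge_center d p a b) \<bullet> (p b - p a) = 0" if "edge_length d a b \<noteq> 0" for x a b
    using edge_center_commute[OF that, of p] by (auto simp: inner_diff_right)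
  show ?thesis
    unfolding triangle_center_def
  proof (rule the_equality)
    show "\<forall>a\<in>{i, j, k}. \<forall>b\<in>{i, j, k}. a \<noteq> b \<longrightarrow> (c - edge_center d p a b) \<bullet> (p b - p a) = 0"
      using ca cb jk on' swap ne by simp
  next
    fix x
    assume x: "\<forall>a\<in>{i, j, k}. \<forall>b\<in>{i, j, k}. a \<noteq> b \<longrightarrow> (x - edge_center d p a b) \<bullet> (p b - p a) = 0"
    then have "(x - p i) \<bullet> (p j - p i) = foot d i j" "(x - p i) \<bullet> (p k - p i) = foot d i k"
      using on' dist by auto
    then have "(x - c) \<bullet> (p j - p i) = 0" "(x - c) \<bullet> (p k - p i) = 0"
      using ca cb by (simp_all add: inner_diff_left)
    then have "x - c = 0"
      by (rule orthogonal_both_eq_0[OF nc])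
    then show "x = c" by simp
  qed
qed

text \<open>Measured by the coefficient of \<open>b\<close>, the line lies at level 0 and the
  segment runs from level \<open>t\<close> to level 1, so it misses the line exactly for positive
  \<open>t\<close>. This turns the case distinction in \<open>height\<close> into the sign of one
  coordinate.\<close>

lemma segment_meets_line_iff:
  fixes a b x :: "'b::real_inner"
  assumes g: "gram a b \<noteq> 0"
  shows "closed_segment (x + (u *\<^sub>R a + t *\<^sub>R b)) (x + b) \<inter> affine hull {x, x + a} = {} \<longleftrightarrow> t > 0"
proof -
  have line: "affine hull {x, x + a} = range (\<lambda>v. x + v *\<^sub>R a)"
  proof -
    show ?thesis unfolding affine_hull_2_alt by simp
  qed
  show ?thesis
  proof (cases "t > 0")
    case True
    have False if "x + v *\<^sub>R a = (1 - r) *\<^sub>R (x + (u *\<^sub>R a + t *\<^sub>R b)) + r *\<^sub>R (x + b)"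
      "0 \<le> r" "r \<le> 1" for r v
    proof -
      define m where "m = (1 - r) * t + r"
      have "m > 0"
        using True that by (cases "r = 0") (auto simp: m_def intro!: add_nonneg_pos)
      have "m *\<^sub>R b = (v - (1 - r) * u) *\<^sub>R a"
        using that(1) by (simp add: m_def algebra_simps)
      then have "b = ((v - (1 - r) * u) / m) *\<^sub>R a"
        using \<open>m > 0\<close> by (metis divide_inverse_commute less_numeral_extra(3) scaleR_scaleR scaleR_one left_inverse)
      then obtain w where "b = w *\<^sub>R a" ..
      with g show False by (simp add: gram_def power2_eq_square)
    qed
    with True show ?thesis
      unfolding line closed_segment_def by auto
  next
    case False
    \<comment> \<open>The parameter at which the level, interpolated linearly from \<open>t\<close>
      to 1, vanishes.\<close>
    define r where "r = - t / (1 - t)"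
    have r: "0 \<le> r" "r \<le> 1" "(1 - r) * t + r = 0"
      using False by (auto simp: r_def field_simps)
    have "(1 - r) *\<^sub>R (x + (u *\<^sub>R a + t *\<^sub>R b)) + r *\<^sub>R (x + b)
        = x + ((1 - r) * u) *\<^sub>R a + ((1 - r) * t + r) *\<^sub>R b"
      by (simp add: algebra_simps)
    also have "\<dots> = x + ((1 - r) * u) *\<^sub>R a" using r by simp
    finally have "x + ((1 - r) * u) *\<^sub>R a \<in> closed_segment (x + (u *\<^sub>R a + t *\<^sub>R b)) (x + b)"
      unfolding closed_segment_def using r by (metis (mono_tags, lifting) mem_Collect_eq)
    with False show ?thesis unfolding line by blast
  qed
qed

text \<open>The signed height is the coordinate of the center along \<open>p k - p i\<close> times
  the altitude \<open>sqrt G / L\<close> of the triangle. The right-hand side contains the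
  realization only through inner products, so any \<open>q\<close> may stand for the one chosen
  inside \<open>height\<close>.\<close>

lemma height_over_length:
  assumes q: "realizes d {i, j, k} q" and ncq: "\<not> collinear {q i, q j, q k}"
    and compat: "compat d i j k" and distinct: "distinct [i, j, k]"
  shows "height d i j k / edge_length d i j =
    (foot d i k - foot d i j * ((q j - q i) \<bullet> (q k - q i)) / (edge_length d i j)\<^sup>2)
      / sqrt (gram (q j - q i) (q k - q i))"
proof -
  define p where "p = (SOME p. realizes d {i, j, k} (p :: _ \<Rightarrow> real ^ 2))"
  have p: "realizes d {i, j, k} p"
    unfolding p_def by (rule someI[of _ q]) (rule q)
  define a b where "a = p j - p i" and "b = p k - p i"
  define L where "L = edge_length d i j"
  have len: "dist (p i) (p j) = dist (q i) (q j)" "dist (p i) (p k) = dist (q i) (q k)"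
    "dist (p j) (p k) = dist (q j) (q k)" "dist (p i) (p j) = L"
    using p q distinct by (simp_all add: realizes_def L_def)
  have g: "gram (q j - q i) (q k - q i) = gram a b"
    unfolding a_def b_def using gram_cong[OF len(1-3)] by simp
  have ab: "(q j - q i) \<bullet> (q k - q i) = a \<bullet> b"
    unfolding a_def b_def inner_eq_sides len ..
  have aa: "a \<bullet> a = L\<^sup>2"
    unfolding a_def len(4)[symmetric] by (simp add: dist_norm norm_minus_commute power2_norm_eq_inner[symmetric])
  define G where "G = gram a b"
  have "G \<noteq> 0" using ncq unfolding collinear_iff_gram g G_def .
  then have G: "G > 0" using gram_nonneg[of a b] by (simp add: G_def)
  have "L \<noteq> 0" using G aa by (auto simp: G_def gram_def)
  then have L: "L > 0" using len(4) zero_le_dist[of "p i" "p j"] by linarith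
  define u v where "u = foot d i j" and "v = foot d i k"
  have uL: "u / L\<^sup>2 = d i j / L"
    using L by (simp add: u_def foot_def L_def power2_eq_square)
  \<comment> \<open>Cramer's rule: \<open>s\<close> and \<open>t\<close> solve the linear system
    saying that \<open>c - p i\<close> has inner products \<open>u\<close> with \<open>a\<close> and
    \<open>v\<close> with \<open>b\<close>.\<close>
  define t where "t = (v * L\<^sup>2 - u * (a \<bullet> b)) / G"
  define s where "s = (u - t * (a \<bullet> b)) / L\<^sup>2"
  define c where "c = p i + (s *\<^sub>R a + t *\<^sub>R b)"
  have pj: "p j = p i + a" and pk: "p k = p i + b" by (simp_all add: a_def b_def)
  have Gt: "G * t = v * L\<^sup>2 - u * (a \<bullet> b)" using G by (simp add: t_def)
  have sL: "s * L\<^sup>2 = u - t * (a \<bullet> b)" using L by (simp add: s_def)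
  have GD: "G = L\<^sup>2 * (b \<bullet> b) - (a \<bullet> b)\<^sup>2" by (simp add: G_def gram_def aa)
  have ca: "(c - p i) \<bullet> (p j - p i) = u"
    using sL by (simp add: c_def pj inner_add_left aa inner_commute[of b a])
  have "L\<^sup>2 * (s * (a \<bullet> b) + t * (b \<bullet> b)) = L\<^sup>2 * v"
    using Gt sL GD by algebra
  then have cb: "(c - p i) \<bullet> (p k - p i) = v"
    using L by (simp add: c_def pk inner_add_left)
  have tc: "triangle_center d p {i, j, k} = c"
    by (rule triangle_center_eq[OF p _ compat distinct])
      (use G ca cb in \<open>simp_all add: G_def u_def v_def a_def b_def\<close>)
  have "c - edge_center d p i j = s *\<^sub>R a + t *\<^sub>R b - (u / L\<^sup>2) *\<^sub>R a"
    unfolding uL by (simp add: c_def edge_center_def L_def[symmetric] a_def)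
  also have "\<dots> = t *\<^sub>R (b - ((a \<bullet> b) / L\<^sup>2) *\<^sub>R a)"
    by (simp add: s_def algebra_simps diff_divide_distrib)
  finally have c_ec: "c - edge_center d p i j = t *\<^sub>R (b - ((a \<bullet> b) / L\<^sup>2) *\<^sub>R a)" .
  have "(norm (b - ((a \<bullet> b) / L\<^sup>2) *\<^sub>R a))\<^sup>2 = G / L\<^sup>2"
    using L unfolding power2_norm_eq_inner
    by (simp add: inner_diff_left inner_diff_right inner_commute aa GD field_simps power2_eq_square)
  then have "norm (b - ((a \<bullet> b) / L\<^sup>2) *\<^sub>R a) = sqrt G / L"
    using L by (metis norm_ge_zero real_sqrt_divide real_sqrt_abs abs_of_pos real_sqrt_unique)
  then have h: "dist c (edge_center d p i j) = \<bar>t\<bar> * (sqrt G / L)"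
    unfolding dist_norm c_ec by simp
  have "height d i j k = t * (sqrt G / L)"
    unfolding height_def Let_def p_def[symmetric] tc h
    using segment_meets_line_iff[of a b "p i" s t] \<open>G \<noteq> 0\<close>
    by (auto simp: G_def pj[symmetric] pk[symmetric] c_def[symmetric])
  then have "height d i j k / L = t * (sqrt G * sqrt G) / (sqrt G * L\<^sup>2)"
    using G L by (simp add: field_simps power2_eq_square del: real_sqrt_mult_self)
  also have "\<dots> = t * G / (sqrt G * L\<^sup>2)" using G by simp
  also have "\<dots> = (v - u * (a \<bullet> b) / L\<^sup>2) / sqrt G"
    using Gt G L by (simp add: field_simps)
  finally show ?thesis
    unfolding g ab L_def[symmetric] u_def v_def G_def .
qed

subsection \<open>Convex planar hinges\<close>

text \<open>A squared area is multiplied by the squared determinant of the coefficients.\<close>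

lemma gram_lincomb:
  "gram (\<alpha> *\<^sub>R a + \<beta> *\<^sub>R b) (\<gamma> *\<^sub>R a + \<delta> *\<^sub>R b) = (\<alpha> * \<delta> - \<beta> * \<gamma>)\<^sup>2 * gram a b"
  by (simp add: gram_def inner_add_left inner_add_right inner_commute[of b a]) algebra

lemma gram_commute: "gram a b = gram b a"
  by (simp add: gram_def inner_commute)

lemma gram_minus: "gram (- a) b = gram a b"
  by (simp add: gram_def)

text \<open>The share of one triangle in the coefficient of an edge in the Dirichlet energy. If the
  centers are circumcenters, it is half the cotangent of the angle at \<open>k\<close>.\<close>

definition weight :: "('a \<Rightarrow> 'a \<Rightarrow> real) \<Rightarrow> 'a \<Rightarrow> 'a \<Rightarrow> 'a \<Rightarrow> real" where
  "weight d i j k = height d i j k / edge_length d i j"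

text \<open>The two diagonals enter symmetrically, and \<open>d\<close> is one function serving all
  four triangles on the vertices, those before and those after the flip. This makes the locale
  closed under relabelling.\<close>

locale convex_hinge =
  fixes d :: "'a \<Rightarrow> 'a \<Rightarrow> real" and p :: "'a \<Rightarrow> real ^ 2"
    and i j k l :: 'a and s r :: real
  assumes dist: "distinct [i, j, k, l]"
    and realizes: "realizes d {i, j, k, l} p"
    and compat: "distinct [a, b, c] \<Longrightarrow> {a, b, c} \<subseteq> {i, j, k, l} \<Longrightarrow> compat d a b c"
    and s: "0 < s" "s < 1" and r: "0 < r" "r < 1"
    and cross: "(1 - s) *\<^sub>R p i + s *\<^sub>R p j = (1 - r) *\<^sub>R p k + r *\<^sub>R p l"
    and nondegenerate: "gram (p j - p i) (p l - p k) \<noteq> 0"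
begin

text \<open>
  Twice the area of the quadrilateral. The diagonals cut it into triangles whose doubled areas are
  \<open>area\<close> times \<open>r\<close>, \<open>1 - r\<close>, \<open>s\<close> or \<open>1 - s\<close>.
\<close>

definition area :: real where
  "area = sqrt (gram (p j - p i) (p l - p k))"

text \<open>
  The numerator of all six weight changes. It does not depend on the labelling of the
  vertices, up to the sign, which tells the two diagonals apart.
\<close>

definition defect :: real where
  "defect = s * foot d i j - r * foot d i l - (1 - r) * foot d i k"

lemma area_pos: "area > 0"
  unfolding area_def using nondegenerate gram_nonneg[of "p j - p i" "p l - p k"]
  by simp

text \<open>This relabelling and the next two carry the edge from \<open>i\<close> to
  \<open>k\<close> to every other boundary edge and exchange the diagonals. One computation at a
  boundary edge and one at a diagonal then cover all six edges.\<close>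

lemma flip_ij: "convex_hinge d p j i k l (1 - s) r"
proof
  show "gram (p i - p j) (p l - p k) \<noteq> 0"
    using nondegenerate gram_minus[of "p j - p i"] by simp
  show "(1 - (1 - s)) *\<^sub>R p j + (1 - s) *\<^sub>R p i = (1 - r) *\<^sub>R p k + r *\<^sub>R p l"
    using cross by (simp add: add.commute)
  have *: "{j, i, k, l} = {i, j, k, l}" by auto
  show "realizes d {j, i, k, l} p"
    unfolding * by (rule realizes)
  show "compat d a b c" if "distinct [a, b, c]" "{a, b, c} \<subseteq> {j, i, k, l}" for a b c
    using compat that unfolding * .
qed (use dist s r in auto)

lemma flip_kl: "convex_hinge d p i j l k s (1 - r)"
proof
  show "gram (p j - p i) (p k - p l) \<noteq> 0"
    using nondegenerate gram_minus[of "p l - p k"] by (simp add: gram_commute)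
  show "(1 - s) *\<^sub>R p i + s *\<^sub>R p j = (1 - (1 - r)) *\<^sub>R p l + (1 - r) *\<^sub>R p k"
    using cross by (simp add: add.commute)
  have *: "{i, j, l, k} = {i, j, k, l}" by auto
  show "realizes d {i, j, l, k} p"
    unfolding * by (rule realizes)
  show "compat d a b c" if "distinct [a, b, c]" "{a, b, c} \<subseteq> {i, j, l, k}" for a b c
    using compat that unfolding * .
qed (use dist s r in auto)

lemma flip_edge: "convex_hinge d p k l i j r s"
proof
  show "gram (p l - p k) (p j - p i) \<noteq> 0"
    using nondegenerate by (simp add: gram_commute)
  have *: "{k, l, i, j} = {i, j, k, l}" by auto
  show "realizes d {k, l, i, j} p"
    unfolding * by (rule realizes)
  show "compat d a b c" if "distinct [a, b, c]" "{a, b, c} \<subseteq> {k, l, i, j}" for a b c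
    using compat that unfolding * .
qed (use dist s r cross in auto)

lemma weight_eq:
  assumes "distinct [a, b, c]" "{a, b, c} \<subseteq> {i, j, k, l}" "gram (p b - p a) (p c - p a) \<noteq> 0"
  shows "weight d a b c =
    (foot d a c - foot d a b * ((p b - p a) \<bullet> (p c - p a)) / ((p b - p a) \<bullet> (p b - p a)))
      / sqrt (gram (p b - p a) (p c - p a))"
proof -
  have rz: "realizes d {a, b, c} p"
    using realizes assms(2) unfolding realizes_def by (meson subsetD)
  have "dist (p a) (p b) = edge_length d a b"
    using rz assms(1) by (simp add: realizes_def)
  then have "(edge_length d a b)\<^sup>2 = (p b - p a) \<bullet> (p b - p a)"
    by (metis dist_commute dist_norm power2_norm_eq_inner)
  then show ?thesis
    using height_over_length[OF rz _ compat[OF assms(1,2)] assms(1)] assms(3)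
    by (simp add: weight_def collinear_iff_gram)
qed

lemma displacement:
  shows "p k - p i = s *\<^sub>R (p j - p i) - r *\<^sub>R (p l - p k)"
    and "p l - p i = s *\<^sub>R (p j - p i) + (1 - r) *\<^sub>R (p l - p k)"
proof -
  show *: "p k - p i = s *\<^sub>R (p j - p i) - r *\<^sub>R (p l - p k)"
    using cross by (simp add: algebra_simps)
  show "p l - p i = s *\<^sub>R (p j - p i) + (1 - r) *\<^sub>R (p l - p k)"
    using * by (simp add: algebra_simps)
qed

lemma gram_triangles:
  shows "sqrt (gram (p k - p i) (p j - p i)) = r * area"
    and "sqrt (gram (p l - p i) (p j - p i)) = (1 - r) * area"
    and "sqrt (gram (p k - p i) (p l - p i)) = s * area"
proof -
  define u v where "u = p j - p i" and "v = p l - p k"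
  have k: "p k - p i = s *\<^sub>R u + (- r) *\<^sub>R v" and l: "p l - p i = s *\<^sub>R u + (1 - r) *\<^sub>R v"
    using displacement by (simp_all add: u_def v_def)
  have j: "p j - p i = 1 *\<^sub>R u + 0 *\<^sub>R v" by (simp add: u_def)
  have coeff: "s * 0 - - r * 1 = r" "s * 0 - (1 - r) * 1 = - (1 - r)" "s * (1 - r) - - r * s = s"
    by (simp_all add: algebra_simps)
  show "sqrt (gram (p k - p i) (p j - p i)) = r * area"
    "sqrt (gram (p l - p i) (p j - p i)) = (1 - r) * area"
    "sqrt (gram (p k - p i) (p l - p i)) = s * area"
    unfolding k l j gram_lincomb coeff real_sqrt_mult area_def u_def[symmetric] v_def[symmetric]
    using s r by simp_all
qed

text \<open>Over the common denominator \<open>r * s * area\<close>, the inner products combine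
  through s (p j - p i) - r (p l - p i) = (1 - r) (p k - p i). They leave (1 - r) times the foot on
  the edge itself, which completes \<open>defect\<close>.\<close>

lemma weight_boundary: "weight d i k j - weight d i k l = defect / (r * s * area)"
proof -
  define b where "b = p k - p i"
  define N where "N = b \<bullet> b"
  have ne: "gram b (p j - p i) \<noteq> 0" "gram b (p l - p i) \<noteq> 0"
    using gram_triangles(1,3) area_pos s r unfolding b_def by auto
  then have N: "N \<noteq> 0" by (auto simp: N_def gram_def)
  have wj: "weight d i k j = (foot d i j - foot d i k * (b \<bullet> (p j - p i)) / N) / (r * area)"
    using weight_eq[of i k j] dist ne gram_triangles(1) by (auto simp: N_def b_def)
  have wl: "weight d i k l = (foot d i l - foot d i k * (b \<bullet> (p l - p i)) / N) / (s * area)"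
    using weight_eq[of i k l] dist ne gram_triangles(3) by (auto simp: N_def b_def)
  have "s *\<^sub>R (p j - p i) - r *\<^sub>R (p l - p i) = (1 - r) *\<^sub>R b"
    unfolding b_def displacement by (simp add: algebra_simps)
  then have "b \<bullet> (s *\<^sub>R (p j - p i) - r *\<^sub>R (p l - p i)) = (1 - r) * N"
    by (simp add: N_def)
  then have N': "s * (b \<bullet> (p j - p i)) - r * (b \<bullet> (p l - p i)) = (1 - r) * N"
    by (simp add: inner_diff_right)
  have "weight d i k j - weight d i k l = (s * foot d i j - r * foot d i l
      - foot d i k * (s * (b \<bullet> (p j - p i)) - r * (b \<bullet> (p l - p i))) / N) / (r * s * area)"
    unfolding wj wl using N s r area_pos by (simp add: field_simps)
  moreover have "foot d i k * ((1 - r) * N) / N = (1 - r) * foot d i k" using N by simp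
  ultimately show ?thesis unfolding N' defect_def by (simp add: algebra_simps)
qed

text \<open>As for a boundary edge, now with (1 - r) (p k - p i) + r (p l - p i) = s (p j - p i).
  Both triangles are on the old side of the flip, so their weights are added.\<close>

lemma weight_diagonal: "weight d i j k + weight d i j l = - defect / (r * (1 - r) * area)"
proof -
  define b where "b = p j - p i"
  define N where "N = b \<bullet> b"
  have ne: "gram b (p k - p i) \<noteq> 0" "gram b (p l - p i) \<noteq> 0"
    using gram_triangles(1,2) area_pos s r unfolding b_def by (auto simp: gram_commute)
  then have N: "N \<noteq> 0" by (auto simp: N_def gram_def)
  have wk: "weight d i j k = (foot d i k - foot d i j * (b \<bullet> (p k - p i)) / N) / (r * area)"
    using weight_eq[of i j k] dist ne gram_triangles(1)
    by (simp add: N_def b_def gram_commute[of "p j - p i"])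
  have wl: "weight d i j l = (foot d i l - foot d i j * (b \<bullet> (p l - p i)) / N) / ((1 - r) * area)"
    using weight_eq[of i j l] dist ne gram_triangles(2)
    by (simp add: N_def b_def gram_commute[of "p j - p i"])
  have "(1 - r) *\<^sub>R (p k - p i) + r *\<^sub>R (p l - p i) = s *\<^sub>R b"
    unfolding b_def displacement by (simp add: algebra_simps)
  then have "b \<bullet> ((1 - r) *\<^sub>R (p k - p i) + r *\<^sub>R (p l - p i)) = s * N"
    by (simp add: N_def)
  then have N': "(1 - r) * (b \<bullet> (p k - p i)) + r * (b \<bullet> (p l - p i)) = s * N"
    by (simp add: inner_add_right)
  have comb: "(x - y * z / N) / (r * area) + (x' - y * z' / N) / ((1 - r) * area)
      = ((1 - r) * x + r * x' - y * ((1 - r) * z + r * z') / N) / (r * (1 - r) * area)" for x y z x' z'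
    using N r area_pos by (simp add: divide_simps) (simp add: algebra_simps)
  show ?thesis
    unfolding wk wl comb N' defect_def using N by (simp add: algebra_simps)
qed

text \<open>By \<open>compat\<close> the differences \<open>foot d a b - foot d b a\<close> sum to
  zero around triangles, so they are differences of a vertex function, obtained by integrating from
  \<open>i\<close>. The values of \<open>w\<close> are the weights of the vertices in a power
  diagram.\<close>

lemma foot_potential:
  obtains w where "\<And>a b. a \<in> {i, j, k, l} \<Longrightarrow> b \<in> {i, j, k, l} \<Longrightarrow> a \<noteq> b \<Longrightarrow>
    foot d a b = ((p b - p a) \<bullet> (p b - p a) + w a - w b) / 2"
proof
  define w where "w = (\<lambda>a. if a = i then 0 else foot d a i - foot d i a)"
  fix a b assume ab: "a \<in> {i, j, k, l}" "b \<in> {i, j, k, l}" "a \<noteq> b"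
  have "foot d a b - foot d b a = w a - w b"
  proof (cases "a = i \<or> b = i")
    case False
    then have "compat d i a b" using compat[of i a b] ab by auto
    then show ?thesis
      using False foot_diff[of d i a] foot_diff[of d a b] foot_diff[of d b i]
      by (simp add: w_def compat_def)
  qed (use ab in \<open>auto simp: w_def\<close>)
  moreover have "dist (p a) (p b) = edge_length d a b"
    using realizes ab unfolding realizes_def by blast
  then have "(edge_length d a b)\<^sup>2 = (p b - p a) \<bullet> (p b - p a)"
    by (metis dist_commute dist_norm power2_norm_eq_inner)
  ultimately show "foot d a b = ((p b - p a) \<bullet> (p b - p a) + w a - w b) / 2"
    using foot_add[of d a b] by simp
qed

text \<open>In terms of the potential, twice \<open>defect\<close> is s (1 - s) u.u - r (1 - r) v.v
  - (1 - s) w i - s w j + (1 - r) w k + r w l. This is unchanged when the ends of a diagonal are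
  exchanged and changes sign when the diagonals are.\<close>

lemma defect_eq:
  shows "(1 - s) * foot d j i - r * foot d j l - (1 - r) * foot d j k = defect"
    and "r * foot d k l - s * foot d k j - (1 - s) * foot d k i = - defect"
proof -
  define u v where "u = p j - p i" and "v = p l - p k"
  obtain w where w: "\<And>a b. a \<in> {i, j, k, l} \<Longrightarrow> b \<in> {i, j, k, l} \<Longrightarrow> a \<noteq> b \<Longrightarrow>
    foot d a b = ((p b - p a) \<bullet> (p b - p a) + w a - w b) / 2"
    using foot_potential by blast
  have e: "p j - p i = u" "p i - p j = - u" "p l - p k = v"
    "p k - p i = s *\<^sub>R u - r *\<^sub>R v" "p l - p i = s *\<^sub>R u + (1 - r) *\<^sub>R v"
    using displacement by (simp_all add: u_def v_def)
  have e': "p k - p j = (s - 1) *\<^sub>R u - r *\<^sub>R v" "p l - p j = (s - 1) *\<^sub>R u + (1 - r) *\<^sub>R v"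
    "p i - p k = r *\<^sub>R v - s *\<^sub>R u" "p j - p k = (1 - s) *\<^sub>R u + r *\<^sub>R v"
  proof -
    have "p k - p j = (p k - p i) - (p j - p i)" "p l - p j = (p l - p i) - (p j - p i)"
      "p i - p k = - (p k - p i)" "p j - p k = (p j - p i) - (p k - p i)"
      by simp_all
    then show "p k - p j = (s - 1) *\<^sub>R u - r *\<^sub>R v" "p l - p j = (s - 1) *\<^sub>R u + (1 - r) *\<^sub>R v"
      "p i - p k = r *\<^sub>R v - s *\<^sub>R u" "p j - p k = (1 - s) *\<^sub>R u + r *\<^sub>R v"
      unfolding e by (simp_all only:) (simp_all add: algebra_simps)
  qed
  have ne: "i \<noteq> j" "j \<noteq> i" "i \<noteq> k" "k \<noteq> i" "i \<noteq> l" "j \<noteq> k" "k \<noteq> j" "j \<noteq> l" "k \<noteq> l"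
    using dist by auto
  have f: "foot d i j = (u \<bullet> u + w i - w j) / 2" "foot d j i = (u \<bullet> u + w j - w i) / 2"
    "foot d k l = (v \<bullet> v + w k - w l) / 2"
    "foot d i k = (s\<^sup>2 * (u \<bullet> u) - 2 * s * r * (u \<bullet> v) + r\<^sup>2 * (v \<bullet> v) + w i - w k) / 2"
    "foot d k i = (s\<^sup>2 * (u \<bullet> u) - 2 * s * r * (u \<bullet> v) + r\<^sup>2 * (v \<bullet> v) + w k - w i) / 2"
    "foot d i l = (s\<^sup>2 * (u \<bullet> u) + 2 * s * (1 - r) * (u \<bullet> v) + (1 - r)\<^sup>2 * (v \<bullet> v) + w i - w l) / 2"
    "foot d j k = ((1 - s)\<^sup>2 * (u \<bullet> u) + 2 * (1 - s) * r * (u \<bullet> v) + r\<^sup>2 * (v \<bullet> v) + w j - w k) / 2"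
    "foot d k j = ((1 - s)\<^sup>2 * (u \<bullet> u) + 2 * (1 - s) * r * (u \<bullet> v) + r\<^sup>2 * (v \<bullet> v) + w k - w j) / 2"
    "foot d j l = ((1 - s)\<^sup>2 * (u \<bullet> u) - 2 * (1 - s) * (1 - r) * (u \<bullet> v) + (1 - r)\<^sup>2 * (v \<bullet> v) + w j - w l) / 2"
    using ne
    by (simp_all add: w e e' inner_commute[of v u] inner_add_left inner_add_right inner_diff_left
        inner_diff_right power2_eq_square algebra_simps)
  show "(1 - s) * foot d j i - r * foot d j l - (1 - r) * foot d j k = defect"
    "r * foot d k l - s * foot d k j - (1 - s) * foot d k i = - defect"
    unfolding defect_def f times_divide_eq_right diff_divide_distrib[symmetric] minus_divide_left
    by (simp_all add: algebra_simps power2_eq_square)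
qed

lemma area_flips:
  shows "convex_hinge.area p j i k l = area" "convex_hinge.area p i j l k = area"
    "convex_hinge.area p j i l k = area" "convex_hinge.area p k l i j = area"
proof -
  show "convex_hinge.area p j i k l = area"
    unfolding area_def convex_hinge.area_def[OF flip_ij] using gram_minus[of "p j - p i"] by simp
  show "convex_hinge.area p i j l k = area"
    unfolding area_def convex_hinge.area_def[OF flip_kl]
    using gram_minus[of "p l - p k" "p j - p i"] by (simp add: gram_commute)
  show "convex_hinge.area p j i l k = area"
    unfolding area_def convex_hinge.area_def[OF convex_hinge.flip_kl[OF flip_ij]]
    using gram_minus[of "p l - p k" "p i - p j"] gram_minus[of "p j - p i" "p l - p k"]
    by (simp add: gram_commute)
  show "convex_hinge.area p k l i j = area"
    unfolding area_def convex_hinge.area_def[OF flip_edge] by (simp add: gram_commute)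
qed

text \<open>The sign change of \<open>defect\<close> under exchange of the diagonals cancels the
  minus sign of \<open>weight_diagonal\<close>. Hence the total weight of the new edge has the sign
  of \<open>defect\<close>.\<close>

lemma weight_flips:
  shows "weight d i l j - weight d i l k = defect / ((1 - r) * s * area)"
    and "weight d j k i - weight d j k l = defect / (r * (1 - s) * area)"
    and "weight d j l i - weight d j l k = defect / ((1 - r) * (1 - s) * area)"
    and "weight d k l i + weight d k l j = defect / (s * (1 - s) * area)"
proof -
  interpret ij: convex_hinge d p j i k l "1 - s" r by (rule flip_ij)
  interpret kl: convex_hinge d p i j l k s "1 - r" by (rule flip_kl)
  interpret b: convex_hinge d p j i l k "1 - s" "1 - r" by (rule ij.flip_kl)
  interpret e: convex_hinge d p k l i j r s by (rule flip_edge)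
  have "ij.defect = defect" "kl.defect = defect" "b.defect = defect" "e.defect = - defect"
    using defect_eq by (simp_all add: ij.defect_def kl.defect_def b.defect_def e.defect_def)
      (simp add: defect_def)
  then show "weight d i l j - weight d i l k = defect / ((1 - r) * s * area)"
    "weight d j k i - weight d j k l = defect / (r * (1 - s) * area)"
    "weight d j l i - weight d j l k = defect / ((1 - r) * (1 - s) * area)"
    "weight d k l i + weight d k l j = defect / (s * (1 - s) * area)"
    using ij.weight_boundary kl.weight_boundary b.weight_boundary e.weight_diagonal area_flips
    by simp_all
qed

text \<open>The left-hand side is twice the energy lost by the hinge. All six coefficients are
  multiples of \<open>defect\<close>, and so is the total weight of the new edge, which therefore
  can serve as the factor on the right.\<close>

lemma energy_drop:
  fixes f :: "'a \<Rightarrow> real"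
  shows "(weight d i j k + weight d i j l) * (f j - f i)\<^sup>2
      + (weight d i k j - weight d i k l) * (f k - f i)\<^sup>2
      + (weight d i l j - weight d i l k) * (f l - f i)\<^sup>2
      + (weight d j k i - weight d j k l) * (f k - f j)\<^sup>2
      + (weight d j l i - weight d j l k) * (f l - f j)\<^sup>2
      - (weight d k l i + weight d k l j) * (f l - f k)\<^sup>2
    = (weight d k l i + weight d k l j) / (r * (1 - r))
        * ((1 - s) * f i + s * f j - (1 - r) * f k - r * f l)\<^sup>2"
proof -
  have *: "- C / (r * r' * A) * (fj - fi)\<^sup>2 + C / (r * s * A) * (fk - fi)\<^sup>2
     + C / (r' * s * A) * (fl - fi)\<^sup>2 + C / (r * s' * A) * (fk - fj)\<^sup>2
     + C / (r' * s' * A) * (fl - fj)\<^sup>2 - C / (s * s' * A) * (fl - fk)\<^sup>2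
     = C / (s * s' * A) / (r * r') * (s' * fi + s * fj - r' * fk - r * fl)\<^sup>2"
    if "A > 0" "r > 0" "r' > 0" "s > 0" "s' > 0" "r + r' = 1" "s + s' = 1"
    for A C fi fj fk fl r r' s s' :: real
  proof -
    define D where "D = r * r' * s * s' * A"
    \<comment> \<open>For coefficients m with sum zero, the square of the sum of m_a f_a equals
      minus the sum of m_a m_b (f_a - f_b)^2 over all pairs. Here m is (s', s, -r', -r).\<close>
    have square: "- (s * s') * (fj - fi)\<^sup>2 + r' * s' * (fk - fi)\<^sup>2 + r * s' * (fl - fi)\<^sup>2
        + r' * s * (fk - fj)\<^sup>2 + r * s * (fl - fj)\<^sup>2 - r * r' * (fl - fk)\<^sup>2
      = (s' * fi + s * fj - r' * fk - r * fl)\<^sup>2"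
    proof -
      have "r' = 1 - r" "s' = 1 - s" using that by auto
      show ?thesis unfolding \<open>r' = 1 - r\<close> \<open>s' = 1 - s\<close> by (simp add: power2_eq_square algebra_simps)
    qed
    have "- C / (r * r' * A) = C * (- (s * s')) / D" "C / (r * s * A) = C * (r' * s') / D"
      "C / (r' * s * A) = C * (r * s') / D" "C / (r * s' * A) = C * (r' * s) / D"
      "C / (r' * s' * A) = C * (r * s) / D" "C / (s * s' * A) = C * (r * r') / D"
      "C / (s * s' * A) / (r * r') = C / D"
      unfolding D_def using that(1-5) by simp_all
    moreover have "C * (- a1) / D * x1 + C * a2 / D * x2 + C * a3 / D * x3 + C * a4 / D * x4
        + C * a5 / D * x5 - C * a6 / D * x6
      = C / D * (- a1 * x1 + a2 * x2 + a3 * x3 + a4 * x4 + a5 * x5 - a6 * x6)"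
      for a1 a2 a3 a4 a5 a6 x1 x2 x3 x4 x5 x6
      by (simp add: algebra_simps)
    ultimately show ?thesis
      unfolding square[symmetric] by (simp only:)
  qed
  show ?thesis
    unfolding weight_boundary weight_diagonal weight_flips
    by (rule *) (use s r area_pos in auto)
qed

end

text \<open>By convexity the segment from \<open>R\<close> to \<open>S\<close> stays in the union of
  two closed triangles. Being connected and meeting both, it meets their intersection, which is the
  other diagonal.\<close>

lemma exists_crossing:
  fixes P Q R S :: "'b::euclidean_space"
  assumes int: "convex hull {P, Q, R} \<inter> convex hull {P, Q, S} = closed_segment P Q"
    and conv: "convex (convex hull {P, Q, R} \<union> convex hull {P, Q, S})"
  obtains s r where "0 \<le> s" "s \<le> 1" "0 \<le> r" "r \<le> 1"
    "(1 - s) *\<^sub>R P + s *\<^sub>R Q = (1 - r) *\<^sub>R R + r *\<^sub>R S"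
proof -
  let ?K = "convex hull {P, Q, R}" and ?L = "convex hull {P, Q, S}"
  have R: "R \<in> ?K" and S: "S \<in> ?L" by (simp_all add: hull_inc)
  have sub: "closed_segment R S \<subseteq> ?K \<union> ?L"
    using conv R S by (intro closed_segment_subset) auto
  have cl: "closed ?K" "closed ?L"
    by (simp_all add: finite_imp_compact_convex_hull compact_imp_closed)
  have "closed_segment R S \<inter> ?K \<inter> ?L \<noteq> {}"
    using connected_closedD[OF connected_segment(1) _ sub cl] R S by fastforce
  then obtain x where "x \<in> closed_segment P Q" "x \<in> closed_segment R S"
    using int by blast
  then show ?thesis
    using that by (auto simp: in_segment)
qed

text \<open>A crossing at the end of a diagonal would make three of the vertices collinear: a new
  triangle degenerates for \<open>s\<close> equal to 0 or 1, an old one for \<open>r\<close> equal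
  to 0 or 1.\<close>

lemma convex_hingeI:
  assumes "distinct [i, j, k, l]" and "realizes d {i, j, k, l} p"
    and "\<And>a b c. distinct [a, b, c] \<Longrightarrow> {a, b, c} \<subseteq> {i, j, k, l} \<Longrightarrow> compat d a b c"
    and nd: "\<And>a b c. distinct [a, b, c] \<Longrightarrow> {a, b, c} \<subseteq> {i, j, k, l} \<Longrightarrow>
      gram (p b - p a) (p c - p a) \<noteq> 0"
    and int: "convex hull (p ` {i, j, k}) \<inter> convex hull (p ` {i, j, l}) = closed_segment (p i) (p j)"
    and conv: "convex (convex hull (p ` {i, j, k}) \<union> convex hull (p ` {i, j, l}))"
  obtains s r where "convex_hinge d p i j k l s r"
proof -
  have "\<exists>s r. 0 \<le> s \<and> s \<le> 1 \<and> 0 \<le> r \<and> r \<le> 1 \<and>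
      (1 - s) *\<^sub>R p i + s *\<^sub>R p j = (1 - r) *\<^sub>R p k + r *\<^sub>R p l"
    by (rule exists_crossing[of "p i" "p j" "p k" "p l"]) (use int conv in auto)
  then obtain s r where sr: "0 \<le> s" "s \<le> 1" "0 \<le> r" "r \<le> 1"
    and cross: "(1 - s) *\<^sub>R p i + s *\<^sub>R p j = (1 - r) *\<^sub>R p k + r *\<^sub>R p l"
    by blast
  have deg: "gram (c *\<^sub>R a) a = 0" for c and a :: "real ^ 2"
    by (simp add: gram_def power2_eq_square)
  have d: "distinct [k, i, l]" "distinct [k, j, l]" "distinct [i, k, j]" "distinct [i, l, j]"
    using assms(1) by auto
  have "p i - p k = r *\<^sub>R (p l - p k)" if "s = 0"
    using cross that by (simp add: algebra_simps)
  then have "s \<noteq> 0" using nd[OF d(1)] deg by auto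
  have "p j - p k = r *\<^sub>R (p l - p k)" if "s = 1"
    using cross that by (simp add: algebra_simps)
  then have "s \<noteq> 1" using nd[OF d(2)] deg by auto
  have "p k - p i = s *\<^sub>R (p j - p i)" if "r = 0"
    using cross that by (simp add: algebra_simps)
  then have "r \<noteq> 0" using nd[OF d(3)] deg by auto
  have "p l - p i = s *\<^sub>R (p j - p i)" if "r = 1"
    using cross that by (simp add: algebra_simps)
  then have "r \<noteq> 1" using nd[OF d(4)] deg by auto
  have k: "p k - p i = s *\<^sub>R (p j - p i) + (- r) *\<^sub>R (p l - p k)"
    using cross by (simp add: algebra_simps)
  have "gram (p k - p i) (1 *\<^sub>R (p j - p i) + 0 *\<^sub>R (p l - p k)) \<noteq> 0"
    using nd[OF d(3)] by simp
  then have "gram (p j - p i) (p l - p k) \<noteq> 0"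
    unfolding k gram_lincomb by simp
  then have "convex_hinge d p i j k l s r"
    using assms(1-3) sr cross \<open>s \<noteq> 0\<close> \<open>s \<noteq> 1\<close> \<open>r \<noteq> 0\<close> \<open>r \<noteq> 1\<close>
    by unfold_locales auto
  then show ?thesis by (rule that)
qed

subsection \<open>Edges and energies under a flip\<close>

lemma triangle_distinct:
  assumes "triangulated_surface T" "{a, b, c} \<in> T"
  shows "distinct [a, b, c]"
proof -
  have "card {a, b, c} = 3" using assms by (auto simp: triangulated_surface_def)
  then show ?thesis by (auto simp: card_insert_if split: if_splits)
qed

text \<open>Each such \<open>x\<close> gives an edge \<open>{b, x}\<close> in the link of
  \<open>a\<close>, a finite cycle. Finiteness matters because \<open>dual_length\<close> is a
  \<open>sum\<close>, which is 0 by default on infinite sets.\<close>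

lemma finite_star:
  assumes T: "triangulated_surface T"
  shows "finite {x. {a, b, x} \<in> T}"
proof (cases "\<exists>x. {a, b, x} \<in> T")
  case True
  then have "is_cycle (link T a)"
    using T unfolding triangulated_surface_def by blast
  then have "finite (link T a)"
    by (auto simp: is_cycle_def)
  moreover have "inj_on (insert b) {{x} | x. {a, b, x} \<in> T}"
    using triangle_distinct[OF T] by (auto simp: inj_on_def doubleton_eq_iff)
  moreover have "insert b ` {{x} | x. {a, b, x} \<in> T} \<subseteq> link T a"
    using triangle_distinct[OF T] by (auto simp: link_def)
  ultimately have "finite {{x} | x. {a, b, x} \<in> T}"
    by (meson finite_imageD finite_subset)
  moreover have "{{x} | x. {a, b, x} \<in> T} = (\<lambda>x. {x}) ` {x. {a, b, x} \<in> T}"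
    by auto
  ultimately show ?thesis
    by (metis (no_types, lifting) finite_imageD inj_onI singleton_inject)
qed auto

text \<open>A vertex has only its successor and its predecessor as neighbours; \<open>a\<close> and
  \<open>b\<close> are distinct, so they exhaust both.\<close>

lemma is_cycle_degree:
  assumes "is_cycle S" "{v, a} \<in> S" "{v, b} \<in> S" "{v, x} \<in> S" "v \<noteq> a" "v \<noteq> b" "v \<noteq> x" "a \<noteq> b"
  shows "x = a \<or> x = b"
proof -
  obtain xs where xs: "distinct xs" "3 \<le> length xs"
    and S: "S = {{xs ! n, xs ! (Suc n mod length xs)} | n. n < length xs}"
    using assms(1) unfolding is_cycle_def by blast
  define L where "L = length xs"
  have idx: "xs ! m = xs ! n \<Longrightarrow> m < L \<Longrightarrow> n < L \<Longrightarrow> m = n" for m n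
    using xs(1) by (simp add: L_def nth_eq_iff_index_eq)
  have L: "L > 0" using xs(2) by (auto simp: L_def)
  have inj: "Suc m mod L = Suc n mod L \<Longrightarrow> m < L \<Longrightarrow> n < L \<Longrightarrow> m = n" for m n
    by (auto simp: mod_Suc split: if_splits)
  have nb: "\<exists>n<L. v = xs ! n \<and> y = xs ! (Suc n mod L) \<or> v = xs ! (Suc n mod L) \<and> y = xs ! n"
    if "{v, y} \<in> S" for y
    using that unfolding S L_def[symmetric] by (auto simp: doubleton_eq_iff)
  have fwd: "y = z" if "v = xs ! m" "y = xs ! (Suc m mod L)" "v = xs ! n" "z = xs ! (Suc n mod L)"
    "m < L" "n < L" for y z m n
    using that idx by metis
  have bwd: "y = z" if "v = xs ! (Suc m mod L)" "y = xs ! m" "v = xs ! (Suc n mod L)" "z = xs ! n"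
    "m < L" "n < L" for y z m n
    using that idx inj L mod_less_divisor by metis
  show ?thesis
    using nb[OF assms(2)] nb[OF assms(3)] nb[OF assms(4)] fwd bwd \<open>a \<noteq> b\<close> by metis
qed

text \<open>In the link of \<open>i\<close> the vertex \<open>j\<close> has only two neighbours, so
  the hinge consists of all triangles at its edge.\<close>

lemma third_vertex:
  assumes T: "triangulated_surface T" and "{i, j, k} \<in> T" "{i, j, l} \<in> T" "k \<noteq> l" "{i, j, x} \<in> T"
  shows "x = k \<or> x = l"
proof (rule is_cycle_degree)
  show "is_cycle (link T i)"
    using T assms(2) unfolding triangulated_surface_def by blast
  have "distinct [i, j, k]" "distinct [i, j, l]" "distinct [i, j, x]"
    using assms triangle_distinct[OF T] by blast+
  then show "{j, k} \<in> link T i" "{j, l} \<in> link T i" "{j, x} \<in> link T i"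
    "j \<noteq> k" "j \<noteq> l" "j \<noteq> x"
    using assms by (auto simp: link_def)
qed fact

text \<open>The predicates \<open>realizes d {a, b, c}\<close> and
  \<open>realizes e {a, b, c}\<close> are equal, so \<open>SOME\<close> picks the same realization
  for both.\<close>

lemma height_cong:
  assumes "distinct [a, b, c]"
    and "\<And>x y. x \<in> {a, b, c} \<Longrightarrow> y \<in> {a, b, c} \<Longrightarrow> x \<noteq> y \<Longrightarrow> d x y = e x y"
  shows "height d a b c = height e a b c"
proof -
  have "realizes d {a, b, c} = realizes e {a, b, c}"
    using assms(2) unfolding realizes_def edge_length_def fun_eq_iff by simp
  moreover have ec: "edge_center d p x y = edge_center e p x y"
    if "x \<in> {a, b, c}" "y \<in> {a, b, c}" "x \<noteq> y" for p x y
    using assms(2)[of x y] assms(2)[of y x] that by (simp add: edge_center_def edge_length_def)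
  moreover have "triangle_center d p {a, b, c} = triangle_center e p {a, b, c}" for p
    unfolding triangle_center_def using ec by (metis (no_types, opaque_lifting))
  ultimately show ?thesis
    using assms(1) unfolding height_def by simp
qed

section \<open>Transfer between local lengths that agree on all edges\<close>

lemma edges_triangle:
  assumes "t \<in> T" "x \<in> t" "y \<in> t" "x \<noteq> y"
  shows "{x, y} \<in> edges T"
  using assms by (auto simp: edges_def)

lemma dual_length_cong:
  assumes T: "triangulated_surface T" and de: "\<And>x y. {x, y} \<in> edges T \<Longrightarrow> d x y = e x y"
  shows "dual_length T d a b = dual_length T e a b"
  unfolding dual_length_def
proof (rule sum.cong)
  fix c assume "c \<in> {c. {a, b, c} \<in> T}"
  then have c: "{a, b, c} \<in> T" by simp
  show "height d a b c = height e a b c"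
    using triangle_distinct[OF T c] de edges_triangle[OF c] by (intro height_cong) simp_all
qed simp

lemma dirichlet_energy_cong:
  assumes T: "triangulated_surface T" and de: "\<And>x y. {x, y} \<in> edges T \<Longrightarrow> d x y = e x y"
  shows "dirichlet_energy T d f = dirichlet_energy T e f"
proof -
  have "on_edge (\<lambda>i j. dual_length T d i j / edge_length d i j * (f j - f i)\<^sup>2) E
      = on_edge (\<lambda>i j. dual_length T e i j / edge_length e i j * (f j - f i)\<^sup>2) E"
    if "E \<in> edges T" for E
  proof -
    have "edge_length d i j = edge_length e i j" if "E = {i, j}" for i j
      using de[of i j] de[of j i] that \<open>E \<in> edges T\<close> by (simp add: edge_length_def insert_commute)
    then have "E = {i, j} \<longrightarrow> y = dual_length T d i j / edge_length d i j * (f j - f i)\<^sup>2 \<longleftrightarrow>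
        y = dual_length T e i j / edge_length e i j * (f j - f i)\<^sup>2" for i j y
      using dual_length_cong[OF T de] by simp
    then show ?thesis
      unfolding on_edge_def by (metis (mono_tags, lifting))
  qed
  then show ?thesis
    unfolding dirichlet_energy_def by (simp cong: infsum_cong)
qed

lemma duality_triangulation_surface: "duality_triangulation T d \<Longrightarrow> triangulated_surface T"
  by (simp only: duality_triangulation_def)

lemma duality_triangulation_realizable:
  "duality_triangulation T d \<Longrightarrow> t \<in> T \<Longrightarrow> \<exists>p. realizes d t p \<and> \<not> collinear (p ` t)"
  by (simp only: duality_triangulation_def)

lemma duality_triangulation_edge_length:
  "duality_triangulation T d \<Longrightarrow> {a, b} \<in> edges T \<Longrightarrow> edge_length d a b > 0"
  by (simp only: duality_triangulation_def)

lemma compat_triangle: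
  assumes "duality_triangulation T d" "{a, b, c} \<in> T"
  shows "compat d a b c"
  using assms unfolding duality_triangulation_def compat_def by blast

lemma duality_triangulation_cong:
  assumes dt: "duality_triangulation T d" and de: "\<And>x y. {x, y} \<in> edges T \<Longrightarrow> d x y = e x y"
  shows "duality_triangulation T e"
proof -
  have T: "triangulated_surface T" using dt by (rule duality_triangulation_surface)
  have len: "edge_length d x y = edge_length e x y" if "{x, y} \<in> edges T" for x y
    using de[of x y] de[of y x] that by (simp add: edge_length_def insert_commute)
  have rz: "realizes d t p = realizes e t p" if "t \<in> T" for t p
    unfolding realizes_def using len[OF edges_triangle[OF that]] by auto
  have cy: "(e i j)\<^sup>2 + (e j k)\<^sup>2 + (e k i)\<^sup>2 = (e j i)\<^sup>2 + (e i k)\<^sup>2 + (e k j)\<^sup>2"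
    if t: "{i, j, k} \<in> T" for i j k
  proof -
    have "d x y = e x y" if "x \<in> {i, j, k}" "y \<in> {i, j, k}" "x \<noteq> y" for x y
      using de edges_triangle[OF t] that by blast
    then have "e i j = d i j" "e j k = d j k" "e k i = d k i" "e j i = d j i" "e i k = d i k" "e k j = d k j"
      using triangle_distinct[OF T t] by auto
    then show ?thesis using compat_triangle[OF dt t] by (simp add: compat_def)
  qed
  have ln: "edge_length e x y > 0" if "{x, y} \<in> edges T" for x y
    using dt len[OF that] that unfolding duality_triangulation_def by metis
  have ex: "\<exists>p. realizes e t p \<and> \<not> collinear (p ` t)" if "t \<in> T" for t
    using dt that rz[OF that] unfolding duality_triangulation_def by metis
  show ?thesis
    unfolding duality_triangulation_def by (intro conjI allI impI ballI T cy ln ex)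
qed

lemma on_edge_eq:
  assumes "F a b = F b a"
  shows "on_edge F {a, b} = F a b"
  unfolding on_edge_def using assms by (intro the_equality) (auto simp: doubleton_eq_iff)

lemma dual_length_commute:
  assumes "edge_length d a b \<noteq> 0"
  shows "dual_length T d a b = dual_length T d b a"
proof -
  have "height d a b c = height d b a c" for c
    using edge_center_commute[OF assms] by (simp add: height_def insert_commute Let_def)
  then show ?thesis
    unfolding dual_length_def by (simp add: insert_commute)
qed

lemma dual_length_flip:
  assumes "finite {x. {a, b, x} \<in> T}" "{a, b, c} \<in> T" "{a, b, c'} \<notin> T"
    and "\<And>x. {a, b, x} \<in> T' \<longleftrightarrow> ({a, b, x} \<in> T \<and> x \<noteq> c) \<or> x = c'"
  shows "dual_length T' d a b = dual_length T d a b - height d a b c + height d a b c'"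
proof -
  have "{x. {a, b, x} \<in> T'} = insert c' ({x. {a, b, x} \<in> T} - {c})"
    using assms(4) by auto
  then show ?thesis
    using assms(1-3) by (simp add: dual_length_def sum_diff1)
qed

text \<open>On the common part the families agree. If they are not summable there, they are not
  summable on the whole sets either, and both sides are the default value 0.\<close>

lemma infsum_mono_finite_change:
  fixes g h :: "'b \<Rightarrow> real"
  assumes A: "finite A" "A \<subseteq> E" and B: "finite B" "B \<subseteq> F" and "E - A = F - B"
    and eq: "\<And>x. x \<in> E - A \<Longrightarrow> g x = h x" and le: "sum g A \<le> sum h B"
  shows "infsum g E \<le> infsum h F"
proof -
  define R where "R = E - A"
  have E: "E = R \<union> A" and F: "F = R \<union> B" and dis: "R \<inter> A = {}" "R \<inter> B = {}"
    using assms by (auto simp: R_def)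
  have eqR: "infsum g R = infsum h R" "g summable_on R \<longleftrightarrow> h summable_on R"
    using eq by (auto simp: R_def intro!: infsum_cong summable_on_cong)
  show ?thesis
  proof (cases "g summable_on R")
    case True
    then have "infsum g E = infsum g R + sum g A" "infsum h F = infsum h R + sum h B"
      unfolding E F using A B dis eqR by (simp_all add: infsum_Un_disjoint)
    then show ?thesis using eqR le by simp
  next
    case False
    then have "\<not> g summable_on E" "\<not> h summable_on F"
      using eqR summable_on_subset_banach[of g E R] summable_on_subset_banach[of h F R]
      by (auto simp: E F)
    then show ?thesis by (simp add: infsum_not_exists)
  qed
qed

lemma gram_triangle:
  assumes dt: "duality_triangulation T d" and t: "{a, b, c} \<in> T" and p: "realizes d {a, b, c} p"
  shows "gram (p b - p a) (p c - p a) \<noteq> 0"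
proof -
  obtain q where q: "realizes d {a, b, c} q" "\<not> collinear (q ` {a, b, c})"
    using duality_triangulation_realizable[OF dt t] by blast
  have "distinct [a, b, c]"
    using triangle_distinct[OF duality_triangulation_surface[OF dt] t] .
  then have "gram (p b - p a) (p c - p a) = gram (q b - q a) (q c - q a)"
    using p q(1) by (intro gram_cong) (simp_all add: realizes_def)
  then show ?thesis
    using q(2) by (simp add: collinear_iff_gram)
qed

lemma triple_eq_iff:
  assumes "c \<noteq> a" "c \<noteq> b"
  shows "{a, b, x} = {a, b, c} \<longleftrightarrow> x = c"
proof
  assume "{a, b, x} = {a, b, c}"
  then have "c \<in> {a, b, x}" by simp
  then show "x = c" using assms by simp
qed simp

lemma edge_of_triangle:
  assumes "card x = 2" "x \<subseteq> {a, b, c}"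
  shows "x = {a, b} \<or> x = {a, c} \<or> x = {b, c}"
proof -
  obtain u v where "x = {u, v}" "u \<noteq> v" using assms(1) unfolding card_2_iff by blast
  with assms(2) show ?thesis by (simp add: doubleton_eq_iff) blast
qed

lemma three_of_four:
  assumes "distinct [i, j, k, l]" "distinct [a, b, c]" "{a, b, c} \<subseteq> {i, j, k, l}"
  shows "{a, b, c} \<in> {{i, j, k}, {i, j, l}, {i, k, l}, {j, k, l}}"
proof -
  have "card {i, j, k, l} = 4" "card {a, b, c} = 3"
    using assms(1,2) by simp_all
  then have "card ({i, j, k, l} - {a, b, c}) = 1"
    using card_Diff_subset[OF _ assms(3)] by simp
  then obtain y where y: "{i, j, k, l} - {a, b, c} = {y}"
    by (auto simp only: card_1_singleton_iff One_nat_def)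
  then have "y \<in> {i, j, k, l}"
    by (metis DiffD1 singletonI)
  moreover have "{a, b, c} = {i, j, k, l} - {y}"
    using double_diff[OF assms(3) subset_refl] unfolding y by (rule sym)
  moreover have "{i, j, k, l} - {i} = {j, k, l}" "{i, j, k, l} - {j} = {i, k, l}"
    "{i, j, k, l} - {k} = {i, j, l}" "{i, j, k, l} - {l} = {i, j, k}"
    using assms(1) by (auto simp: insert_Diff_if)
  ultimately show ?thesis
    by (elim insertE emptyE) (simp_all only: insert_iff simp_thms)
qed

theorem theorem31:
  fixes T T' :: "'a set set" and d d' :: "'a \<Rightarrow> 'a \<Rightarrow> real" and f :: "'a \<Rightarrow> real"
    and i j k l :: 'a
  assumes "duality_triangulation T d"
    and "duality_triangulation T' d'"
    and "bistellar_flip T d i j k l T' d'"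
    and "locally_regular T' d' k l"
  shows "dirichlet_energy T' d' f \<le> dirichlet_energy T d f"
proof -
  have T: "triangulated_surface T" and T': "triangulated_surface T'"
    using assms(1,2) by (auto intro: duality_triangulation_surface)
  have ijk: "{i, j, k} \<in> T" and ijl: "{i, j, l} \<in> T" and "k \<noteq> l" and kl: "{k, l} \<notin> edges T"
    and T'_eq: "T' = T - {{i, j, k}, {i, j, l}} \<union> {{i, k, l}, {j, k, l}}"
    and agree: "\<And>a b. {a, b} \<in> edges T \<Longrightarrow> {a, b} \<noteq> {i, j} \<Longrightarrow> d' a b = d a b"
    using assms(3) by (auto simp: bistellar_flip_def)
  obtain p where p: "embeds_hinge d i j k l p"
    and conv: "convex (convex hull (p ` {i, j, k}) \<union> convex hull (p ` {i, j, l}))"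
    and len_kl: "d' k l + d' l k = dist (p k) (p l)"
    using assms(3) by (auto simp: bistellar_flip_def)
  have dist: "distinct [i, j, k, l]"
    using triangle_distinct[OF T ijk] triangle_distinct[OF T ijl] \<open>k \<noteq> l\<close> by auto
  then have ne: "i \<noteq> j" "i \<noteq> k" "i \<noteq> l" "j \<noteq> k" "j \<noteq> l" "k \<noteq> l"
    "j \<noteq> i" "k \<noteq> i" "l \<noteq> i" "k \<noteq> j" "l \<noteq> j" "l \<noteq> k" by auto
  have ikl': "{i, k, l} \<in> T'" and jkl': "{j, k, l} \<in> T'" by (simp_all add: T'_eq)
  have no_kl: "t \<notin> T" if "k \<in> t" "l \<in> t" for t
    using edges_triangle[of t T k l] that kl ne by blast
  have star_ij: "{i, j, x} \<in> T \<longleftrightarrow> x = k \<or> x = l" for x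
    using third_vertex[OF T ijk ijl \<open>k \<noteq> l\<close>] ijk ijl by blast
  have star_kl: "{k, l, x} \<in> T' \<longleftrightarrow> x = i \<or> x = j" for x
  proof -
    have "{i, k, l} = {k, l, i}" "{j, k, l} = {k, l, j}"
      by (simp_all add: insert_commute)
    then have "{k, l, x} = {i, k, l} \<longleftrightarrow> x = i" "{k, l, x} = {j, k, l} \<longleftrightarrow> x = j"
      using ne triple_eq_iff by metis+
    then show ?thesis using no_kl[of "{k, l, x}"] by (simp add: T'_eq)
  qed
  \<comment> \<open>A triangle of \<open>T'\<close> containing \<open>i\<close> and \<open>j\<close>
    would belong to \<open>T\<close>, hence be one of the two removed ones. So the two sets of local
    lengths can be merged without conflict.\<close>
  have ij: "{i, j} \<notin> edges T'"
  proof
    assume "{i, j} \<in> edges T'"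
    then obtain t where t: "t \<in> T'" "i \<in> t" "j \<in> t" by (auto simp: edges_def)
    then have tT: "t \<in> T" "t \<noteq> {i, j, k}" "t \<noteq> {i, j, l}"
      using ne by (auto simp: T'_eq)
    have "card (t - {i, j}) = 1"
      using tT(1) T t ne by (subst card_Diff_subset) (auto simp: triangulated_surface_def)
    then obtain x where "t - {i, j} = {x}" by (auto simp: card_1_singleton_iff)
    then have tx: "t = {i, j, x}" using t by blast
    then have "x = k \<or> x = l" using tT(1) star_ij[of x] by simp
    then show False using tT tx by auto
  qed

  \<comment> \<open>A single function of local lengths that serves both triangulations.\<close>
  define e where "e = (\<lambda>a b. if {a, b} = {i, j} then d a b else d' a b)"
  have de: "d a b = e a b" if "{a, b} \<in> edges T" for a b
    using agree that by (simp add: e_def)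
  have d'e: "d' a b = e a b" if "{a, b} \<in> edges T'" for a b
    using ij that by (auto simp: e_def)
  have dt: "duality_triangulation T e" and dt': "duality_triangulation T' e"
    using duality_triangulation_cong[OF assms(1) de] duality_triangulation_cong[OF assms(2) d'e]
    by simp_all
  have en: "dirichlet_energy T d f = dirichlet_energy T e f"
    "dirichlet_energy T' d' f = dirichlet_energy T' e f"
    using dirichlet_energy_cong[OF T de] dirichlet_energy_cong[OF T' d'e] by simp_all

  have pos: "edge_length e a b > 0" if "{a, b} \<in> edges T \<union> edges T'" for a b
    using that duality_triangulation_edge_length[OF dt] duality_triangulation_edge_length[OF dt'] by blast
  \<comment> \<open>Five of the distances come from the embedded hinge, the sixth from the choice of
    \<open>d'\<close> on the new diagonal.\<close>
  have rz: "realizes e {i, j, k, l} p"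
  proof -
    have eq: "edge_length e a b = edge_length d a b" if "{a, b} \<in> edges T" for a b
      using de[of a b] de[of b a] that by (simp add: edge_length_def insert_commute)
    have "edge_length e k l = dist (p k) (p l)"
      using len_kl ne by (simp add: e_def edge_length_def doubleton_eq_iff)
    moreover have "dist (p a) (p b) = edge_length e a b"
      if "{a, b} \<subseteq> {i, j, k} \<or> {a, b} \<subseteq> {i, j, l}" "a \<noteq> b" for a b
      using that p eq edges_triangle[OF ijk] edges_triangle[OF ijl]
      unfolding embeds_hinge_def realizes_def by (metis insert_subset)
    ultimately show ?thesis
      unfolding realizes_def by (auto simp: dist_commute edge_length_commute)
  qed
  \<comment> \<open>All triples of the four vertices are triangles before or after the flip, which
    supplies \<open>compat\<close> and nondegeneracy for the locale.\<close>
  have tri: "{a, b, c} \<in> T \<or> {a, b, c} \<in> T'" if "distinct [a, b, c]" "{a, b, c} \<subseteq> {i, j, k, l}" for a b c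
    using three_of_four[OF dist that] ijk ijl ikl' jkl' by auto
  obtain s r where "convex_hinge e p i j k l s r"
  proof (rule convex_hingeI[OF dist rz])
    fix a b c assume abc: "distinct [a, b, c]" "{a, b, c} \<subseteq> {i, j, k, l}"
    show "compat e a b c"
      using tri[OF abc] compat_triangle[OF dt] compat_triangle[OF dt'] by blast
    have "realizes e {a, b, c} p"
      using rz abc(2) unfolding realizes_def by (meson subsetD)
    then show "gram (p b - p a) (p c - p a) \<noteq> 0"
      using tri[OF abc] gram_triangle[OF dt] gram_triangle[OF dt'] by blast
  next
    show "convex hull (p ` {i, j, k}) \<inter> convex hull (p ` {i, j, l}) = closed_segment (p i) (p j)"
      using p by (simp add: embeds_hinge_def)
  qed (use conv in auto)
  then interpret convex_hinge e p i j k l s r .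

  define F where "F = (\<lambda>S a b. dual_length S e a b / edge_length e a b * (f b - f a)\<^sup>2)"
  have F_edge: "on_edge (F S) {a, b} = F S a b" if "{a, b} \<in> edges T \<union> edges T'" for S a b
  proof (rule on_edge_eq)
    show "F S a b = F S b a"
      using dual_length_commute[of e a b S] pos[OF that]
      by (simp add: F_def edge_length_commute power2_commute)
  qed
  \<comment> \<open>The boundary of the hinge. Only the summands of these four edges and of the two
    diagonals are affected by the flip.\<close>
  define B where "B = {{i, k}, {i, l}, {j, k}, {j, l}}"
  have in_T: "{i, j} \<in> edges T" "{i, k} \<in> edges T" "{i, l} \<in> edges T" "{j, k} \<in> edges T"
    "{j, l} \<in> edges T" and in_T': "{k, l} \<in> edges T'"
    "{i, k} \<in> edges T'" "{i, l} \<in> edges T'" "{j, k} \<in> edges T'" "{j, l} \<in> edges T'"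
    using edges_triangle[OF ijk] edges_triangle[OF ijl] edges_triangle[OF ikl'] edges_triangle[OF jkl'] ne
    by auto

  have old: "x \<in> insert {i, j} B" if "card x = 2" "x \<subseteq> {i, j, k} \<or> x \<subseteq> {i, j, l}" for x
    using edge_of_triangle[OF that(1)] that(2) unfolding B_def insert_iff by metis
  have new: "x \<in> insert {k, l} B" if "card x = 2" "x \<subseteq> {i, k, l} \<or> x \<subseteq> {j, k, l}" for x
    using edge_of_triangle[OF that(1)] that(2) unfolding B_def insert_iff by metis
  have rest: "edges T' - insert {k, l} B = edges T - insert {i, j} B"
  proof (intro subset_antisym subsetI)
    fix x assume x: "x \<in> edges T' - insert {k, l} B"
    then obtain t where t: "card x = 2" "t \<in> T'" "x \<subseteq> t" by (auto simp: edges_def)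
    then have "t \<in> T" using new[of x] x by (auto simp: T'_eq)
    then show "x \<in> edges T - insert {i, j} B" using x ij t by (auto simp: edges_def)
  next
    fix x assume x: "x \<in> edges T - insert {i, j} B"
    then obtain t where t: "card x = 2" "t \<in> T" "x \<subseteq> t" by (auto simp: edges_def)
    then have "t \<in> T'" using old[of x] x by (auto simp: T'_eq)
    then show "x \<in> edges T' - insert {k, l} B" using x kl t by (auto simp: edges_def)
  qed
  have F_rest: "on_edge (F T') x = on_edge (F T) x" if x: "x \<in> edges T' - insert {k, l} B" for x
  proof -
    obtain a b where ab: "x = {a, b}" "a \<noteq> b" using x by (auto simp: edges_def card_2_iff)
    have "card x = 2" using ab by simp
    have "x \<notin> insert {i, j} B" "x \<notin> insert {k, l} B"
      using x x[unfolded rest] by (simp_all only: Diff_iff not_False_eq_True)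
    then have no: "\<not> x \<subseteq> t" if "t \<in> {{i, j, k}, {i, j, l}, {i, k, l}, {j, k, l}}" for t
      using old[OF \<open>card x = 2\<close>] new[OF \<open>card x = 2\<close>] that by (elim insertE emptyE) metis+
    have "{a, b, c} \<in> T' \<longleftrightarrow> {a, b, c} \<in> T" for c
    proof -
      have "x \<subseteq> {a, b, c}" using ab by auto
      then have "{a, b, c} \<notin> {{i, j, k}, {i, j, l}, {i, k, l}, {j, k, l}}"
        using no by metis
      then show ?thesis by (simp add: T'_eq)
    qed
    then have "F T' a b = F T a b" by (simp add: F_def dual_length_def)
    then show ?thesis using F_edge[of a b] x ab by auto
  qed

  have dual_ij: "dual_length T e i j = height e i j k + height e i j l"
    using \<open>k \<noteq> l\<close> by (simp add: dual_length_def star_ij Collect_disj_eq)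
  have dual_kl: "dual_length T' e k l = height e k l i + height e k l j"
    using ne by (simp add: dual_length_def star_kl Collect_disj_eq)
  \<comment> \<open>One statement for the four boundary edges: \<open>a\<close> is an end of the old
    diagonal with opposite end \<open>a'\<close>, and \<open>b\<close> is an end of the new one with
    opposite end \<open>b'\<close>. The flip replaces the third vertex \<open>a'\<close> over the
    edge by \<open>b'\<close>.\<close>
  have dual_flip: "dual_length T' e a b = dual_length T e a b - height e a b a' + height e a b b'"
    if "a = i \<and> a' = j \<or> a = j \<and> a' = i" "b = k \<and> b' = l \<or> b = l \<and> b' = k" for a b a' b'
  proof (rule dual_length_flip)
    show "finite {x. {a, b, x} \<in> T}" by (rule finite_star[OF T])
    show "{a, b, a'} \<in> T" using that ijk ijl by (auto simp: insert_commute)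
    show "{a, b, b'} \<notin> T" using that no_kl[of "{a, b, b'}"] by (elim disjE conjE) simp_all
    fix x
    have "{a, b, x} = {a, b, c} \<longleftrightarrow> x = c" if "c \<noteq> a" "c \<noteq> b" for c
      using that by (rule triple_eq_iff)
    moreover have "a' \<noteq> a" "a' \<noteq> b" "b' \<noteq> a" "b' \<noteq> b" using that ne by auto
    moreover have "T' = T - {{a, b, a'}, {a, a', b'}} \<union> {{a, b, b'}, {a', b, b'}}"
      using that by (elim disjE conjE) (simp_all only: T'_eq insert_commute)
    moreover have "b \<notin> {a, a', b'}" "a \<notin> {a', b, b'}"
      using that ne by auto
    then have "{a, b, x} \<noteq> {a, a', b'}" "{a, b, x} \<noteq> {a', b, b'}"
      by (metis insertCI)+
    ultimately show "{a, b, x} \<in> T' \<longleftrightarrow> ({a, b, x} \<in> T \<and> x \<noteq> a') \<or> x = b'"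
      by (simp add: disj_commute)
  qed
  have F_flip: "F T a b - F T' a b = (weight e a b a' - weight e a b b') * (f b - f a)\<^sup>2"
    if "a = i \<and> a' = j \<or> a = j \<and> a' = i" "b = k \<and> b' = l \<or> b = l \<and> b' = k" for a b a' b'
    unfolding F_def dual_flip[OF that] weight_def
    by (simp add: diff_divide_distrib add_divide_distrib algebra_simps)
  have F_ij: "F T i j = (weight e i j k + weight e i j l) * (f j - f i)\<^sup>2"
    unfolding F_def weight_def dual_ij add_divide_distrib ..
  have F_kl: "F T' k l = (weight e k l i + weight e k l j) * (f l - f k)\<^sup>2"
    unfolding F_def weight_def dual_kl add_divide_distrib ..
  have sum_T: "(\<Sum>x\<in>insert {i, j} B. on_edge (F T) x) =
      F T i j + F T i k + F T i l + F T j k + F T j l"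
    using ne in_T by (simp add: B_def F_edge doubleton_eq_iff)
  have sum_T': "(\<Sum>x\<in>insert {k, l} B. on_edge (F T') x) =
      F T' k l + F T' i k + F T' i l + F T' j k + F T' j l"
    using ne in_T' by (simp add: B_def F_edge doubleton_eq_iff)
  have "dual_length T' e k l > 0"
    using assms(4) dual_length_cong[OF T' d'e] by (simp add: locally_regular_def)
  then have "weight e k l i + weight e k l j > 0"
    using pos[of k l] in_T' by (simp add: weight_def dual_kl add_divide_distrib[symmetric])
  then have "(weight e k l i + weight e k l j) / (r * (1 - r))
        * ((1 - s) * f i + s * f j - (1 - r) * f k - r * f l)\<^sup>2 \<ge> 0"
    using r by simp
  \<comment> \<open>By \<open>F_flip\<close>, \<open>F_ij\<close> and \<open>F_kl\<close>, the
    left-hand side of \<open>energy_drop\<close> is the difference of these two sums.\<close>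
  then have "(\<Sum>x\<in>insert {k, l} B. on_edge (F T') x) \<le> (\<Sum>x\<in>insert {i, j} B. on_edge (F T) x)"
    using energy_drop[of f] F_flip[of i j k l] F_flip[of i j l k] F_flip[of j i k l] F_flip[of j i l k]
    unfolding sum_T sum_T' F_ij F_kl by simp
  then have "infsum (on_edge (F T')) (edges T') \<le> infsum (on_edge (F T)) (edges T)"
    using in_T in_T' rest F_rest
    by (intro infsum_mono_finite_change[of "insert {k, l} B" _ "insert {i, j} B"]) (auto simp: B_def)
  then show ?thesis
    unfolding en unfolding dirichlet_energy_def F_def by simp
qed

end
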